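(* Let $(X,d)$ be a nonempty metric space with the finite doubling property and let $0<r<\tfrac13$. Put $c=\tfrac12-\tfrac{r}{1-r}$ and $C=\tfrac{1}{1-r}$. Then there exist index sets $N_k\subset\mathbb{N}$ ($k\in\mathbb{Z}$), a collection $\{Q_{k,i} : k\in\mathbb{Z},\ i\in N_k\}$ of Borel subsets of $X$, and points $x_{k,i}\in X$ ($k\in\mathbb{Z}$, $i\in N_k$) having the following properties: (i) $X=\bigcup_{i\in N_k}Q_{k,i}$ for every $k\in\mathbb{Z}$; (ii) whenever $k,m\in\mathbb{Z}$, $k\ge m$, $i\in N_k$ and $j\in N_m$, either $Q_{k,i}\cap Q_{m,j}=\emptyset$ or $Q_{k,i}\subset Q_{m,j}$; (iii) for every $k\in\mathbb{Z}$ and $i\in N_k$, \[ U(x_{k,i},c\,r^k)\subset Q_{k,i}\subset B(x_{k,i},C\,r^k); \] (iv) there exists a point $x_0\in X$ such that for every $k\in\mathbb{Z}$ there is $i\in N_k$ with \[ U(x_0,c\,r^k)\subset Q_{k,i}; \] (v) $\{x_{k,i} : i\in N_k\}\subset\{x_{k+1,i} : i\in N_{k+1}\}$ for all $k\in\mathbb{Z}$.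
   Context: In a metric space $(X,d)$, $B(x,t)=\{y\in X : d(x,y)\le t\}$ denotes the closed ball and $U(x,t)=\{y\in X : d(x,y)<t\}$ the open ball with centre $x\in X$ and radius $t>0$. The metric space $X$ has the finite doubling property if for every $x\in X$ and $t>0$ the ball $B(x,2t)$ can be covered by finitely many closed balls of radius $t$ (the number may depend on $x$ and $t$). *)

theory Defs
  imports "HOL-Analysis.Analysis"
begin

text \<open>The metric space is the whole type; it is automatically nonempty. The centres of the
  covering balls range over the whole space, and their number may depend on the ball covered.\<close>

definition finite_doubling :: "'a::metric_space itself \<Rightarrow> bool" where
  "finite_doubling _ \<longleftrightarrow>
     (\<forall>(x::'a) t. t > 0 \<longrightarrow> (\<exists>F. finite F \<and> cball x (2 * t) \<subseteq> (\<Union>y\<in>F. cball y t)))"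

end

theory Submission
  imports Defs
begin

text \<open>Write \<open>d\<close> for the distance and \<open>A k\<close> for the set of centres of generation \<open>k\<close>. These sets
  are to be nested in \<open>k\<close>, \<open>r^k\<close>-separated and \<open>r^k\<close>-dense. There is no coarsest generation to start
  from, but \<open>x0\<close> alone serves all points \<open>y\<close> at the scales \<open>r^k > d(x0, y)\<close>. So the remaining pairs
  \<open>(k, y)\<close> can be well-ordered by the integer part of \<open>d(x0, y) - r^k/2\<close>, then by \<open>k\<close>, and accepted
  greedily: a finer pair treated earlier lies too far away to obstruct a coarser one.

  Each centre of generation \<open>k + 1\<close> has its nearest centre of generation \<open>k\<close> as parent. Every point
  lies in the closure of the set of descendants of some centre, and these closures are passed on from
  parents to children. Hence one can choose, in a Borel way, for every point \<open>y\<close> a sequence of centres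
  \<open>s k y\<close> compatible with the parent map, and the cubes are the fibres of \<open>s k\<close>. The geometric series of
  the parent distances gives the outer radius. For the inner one, if \<open>y\<close> is within \<open>c r^k\<close> of a centre
  \<open>a\<close>, then \<open>s (k + 1) y\<close> is within \<open>r^k/2\<close> of \<open>a\<close>, so its parent is \<open>a\<close>.\<close>

section \<open>Nested separated nets by greedy choice\<close>

lemma greedy_independent_set:
  assumes "wf R"
  obtains G where "G \<subseteq> S"
    and "\<And>x. x \<in> S \<Longrightarrow> x \<in> G \<longleftrightarrow> (\<forall>z\<in>G. (z, x) \<in> R \<longrightarrow> indep z x)"
proof -
  define F where "F = (\<lambda>f x. x \<in> S \<and> (\<forall>z. (z, x) \<in> R \<longrightarrow> f z \<longrightarrow> indep z x))"
  define P where "P = wfrec R F"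
  have "P x = F (cut P R x) x" for x
    unfolding P_def by (rule wfrec[OF assms])
  \<comment> \<open>\<open>F\<close> consults its first argument only at
    \<open>R\<close>-predecessors of \<open>x\<close>, where \<open>cut\<close> changes
    nothing.\<close>
  also have "F (cut P R x) x = F P x" for x
    by (auto simp: F_def cut_def)
  finally have P: "P x \<longleftrightarrow> x \<in> S \<and> (\<forall>z. (z, x) \<in> R \<longrightarrow> P z \<longrightarrow> indep z x)" for x
    unfolding F_def .
  show thesis
  proof (rule that[of "Collect P"])
    show "Collect P \<subseteq> S" using P by blast
    show "x \<in> Collect P \<longleftrightarrow> (\<forall>z\<in>Collect P. (z, x) \<in> R \<longrightarrow> indep z x)" if "x \<in> S" for x
      using P[of x] that by blast
  qed
qed

lemma powi_less_le_mult:
  fixes r :: real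
  assumes "0 < r" "r < 1" "k < j"
  shows "r powi j \<le> r * r powi k"
proof -
  have "r powi j \<le> r powi (k + 1)"
    using assms by (intro power_int_decreasing) auto
  also have "\<dots> = r * r powi k"
    using assms by (simp add: power_int_add)
  finally show ?thesis .
qed

lemma powi_at_bot_bound:
  fixes r B :: real
  assumes "0 < r" "r < 1"
  obtains K :: int where "\<And>k. k < K \<Longrightarrow> B \<le> r powi k"
proof -
  obtain n where n: "B < inverse r ^ n"
    using real_arch_pow[of "inverse r" B] assms one_less_inverse by blast
  show thesis
  proof (rule that[of "- int n"])
    fix k :: int assume "k < - int n"
    then have "r powi (- int n) \<le> r powi k"
      using assms by (intro power_int_decreasing) auto
    then show "B \<le> r powi k"
      using n by (simp add: power_int_minus power_inverse)
  qed
qed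

lemma ex_nested_nets:
  fixes x0 :: "'a::metric_space" and r :: real
  assumes r: "0 < r" "r \<le> 1/3"
  obtains A :: "int \<Rightarrow> 'a set" where
    "\<And>k. x0 \<in> A k" "\<And>k. A k \<subseteq> A (k + 1)"
    "\<And>k a b. a \<in> A k \<Longrightarrow> b \<in> A k \<Longrightarrow> a \<noteq> b \<Longrightarrow> r powi k \<le> dist a b"
    "\<And>k y. \<exists>a\<in>A k. dist y a < r powi k"
proof -
  obtain W where W: "well_order_on (UNIV :: 'a set) W"
    using well_order_on by blast
  \<comment> \<open>On \<open>S\<close> the value is at least \<open>r powi k / 2\<close>, hence
    positive, so \<open>nat\<close> in \<open>n\<close> truncates nothing there.\<close>
  define h where "h = (\<lambda>(k, y). dist x0 y - r powi k / 2)"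
  define n where "n = (\<lambda>p. nat \<lfloor>h p\<rfloor>)"
  \<comment> \<open>Comparing generations within a level is well-founded only if they are bounded
    below. They are: on \<open>S\<close>, \<open>r powi k / 2 \<le> h p < m + 1\<close> at level
    \<open>m\<close>.\<close>
  obtain K where K: "2 * (real m + 1) \<le> r powi k" if "k < K m" for m k
  proof -
    have "\<exists>K. \<forall>k<K. 2 * (real m + 1) \<le> r powi k" for m
      using powi_at_bot_bound[of r "2 * (real m + 1)"] r by auto
    then show thesis using that by metis
  qed
  \<comment> \<open>The shift by \<open>K\<close> makes the second component injective on the relevant generations, where
      \<open>nat\<close> would otherwise truncate.\<close>
  define key where "key = (\<lambda>p. (n p, nat (fst p - K (n p)), snd p))"
  define R where "R = inv_image (less_than <*lex*> less_than <*lex*> (W - Id)) key"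
  define S where "S = {(k, y). r powi k \<le> dist x0 y}"
  \<comment> \<open>\<open>max j k\<close> is the first generation that must contain both points, so
    its scale is the separation required. A point accepted in several generations does not conflict
    with itself.\<close>
  define indep where
    "indep = (\<lambda>(j, z :: 'a) (k :: int, y). z = y \<or> r powi (max j k) \<le> dist z y)"
  have wfR: "wf R"
    unfolding R_def using W by (intro wf_inv_image wf_lex_prod wf_less_than) (auto simp: well_order_on_def)
  have K_le: "K (n p) \<le> fst p" if "p \<in> S" for p
  proof (rule ccontr)
    assume "\<not> ?thesis"
    then have *: "2 * (real (n p) + 1) \<le> r powi (fst p)" using K by simp
    have "r powi (fst p) / 2 \<le> h p"
      using that by (auto simp: S_def h_def)
    moreover have "h p < real (n p) + 1"
      unfolding n_def by linarith
    ultimately have "r powi (fst p) < 2 * (real (n p) + 1)" by simp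
    then show False using * by simp
  qed
  have total: "(p, q) \<in> R \<or> (q, p) \<in> R" if "p \<in> S" "q \<in> S" "p \<noteq> q" for p q
  proof -
    have "total W" using W by (auto simp: well_order_on_def linear_order_on_def)
    then have "snd p \<noteq> snd q \<Longrightarrow> (snd p, snd q) \<in> W - Id \<or> (snd q, snd p) \<in> W - Id"
      by (auto simp: total_on_def)
    then show ?thesis
      using K_le[OF that(1)] K_le[OF that(2)] that(3)
      by (cases p; cases q) (auto simp: R_def key_def)
  qed
  obtain G where GS: "G \<subseteq> S"
    and G: "\<And>p. p \<in> S \<Longrightarrow> p \<in> G \<longleftrightarrow> (\<forall>q\<in>G. (q, p) \<in> R \<longrightarrow> indep q p)"
    using greedy_independent_set[OF wfR] by metis
  have indep_sym: "indep p q \<longleftrightarrow> indep q p" for p q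
    by (cases p; cases q) (auto simp: indep_def dist_commute max.commute)
  \<comment> \<open>By totality one of two distinct pairs comes earlier, and the later one was
    accepted only as independent of it.\<close>
  have indep: "indep p q" if "p \<in> G" "q \<in> G" for p q
  proof (cases "p = q")
    case True
    then show ?thesis by (auto simp: indep_def split: prod.splits)
  next
    case False
    then show ?thesis using total[of p q] G[of p] G[of q] GS that indep_sym by blast
  qed
  define A where "A k = insert x0 {y. \<exists>j\<le>k. (j, y) \<in> G}" for k
  have mono: "r powi k \<le> r powi j" if "j \<le> k" for j k :: int
    using r that by (intro power_int_decreasing) auto
  show thesis
  proof (rule that[of A])
    show "x0 \<in> A k" for k by (simp add: A_def)
    show "A k \<subseteq> A (k + 1)" for k by (force simp: A_def)
    show "r powi k \<le> dist a b" if ab: "a \<in> A k" "b \<in> A k" "a \<noteq> b" for k a b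
    proof -
      have x0: "r powi k \<le> dist x0 y" if "j \<le> k" "(j, y) \<in> G" for j y
        using that GS mono[of j k] by (force simp: S_def)
      have "r powi k \<le> dist a b" if "i \<le> k" "j \<le> k" "(i, a) \<in> G" "(j, b) \<in> G" for i j
        using indep[OF that(3,4)] ab(3) mono[of "max i j" k] that(1,2) by (auto simp: indep_def)
      then show ?thesis
        using ab x0 by (auto simp: A_def dist_commute)
    qed
    show "\<exists>a\<in>A k. dist y a < r powi k" for k y
    proof (rule ccontr)
      assume "\<not> ?thesis"
      then have far: "r powi k \<le> dist y a" if "a \<in> A k" for a
        using that by force
      then have S: "(k, y) \<in> S"
        by (auto simp: S_def A_def dist_commute)
      have "y \<notin> A k"
        using far[of y] zero_less_power_int[OF r(1), of k] by auto
      then have "(k, y) \<notin> G" by (auto simp: A_def)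
      then obtain j z where z: "(j, z) \<in> G" "((j, z), (k, y)) \<in> R" "\<not> indep (j, z) (k, y)"
        using G[OF S] by auto
      show False
      proof (cases "j \<le> k")
        case True
        then show False
          using z far[of z] by (auto simp: A_def indep_def dist_commute)
      next
        case False
        \<comment> \<open>As \<open>j > k\<close>, the generation component favours
          \<open>(k, y)\<close>; so \<open>(j, z)\<close> can precede it only by a strictly lower
          level.\<close>
        then have "n (j, z) < n (k, y)"
          using z(2) K_le[OF S] K_le[of "(j, z)"] z(1) GS by (auto simp: R_def key_def)
        then have "h (j, z) < h (k, y)"
          unfolding n_def by linarith
        \<comment> \<open>The comparison of \<open>h\<close> gives
          \<open>dist z y > (r powi k - r powi j) / 2\<close>, and the factor 3 makes this at least
          \<open>r powi j\<close>.\<close>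
        moreover have "3 * r powi j \<le> r powi k"
        proof -
          have "r powi j \<le> r * r powi k"
            using False r by (intro powi_less_le_mult) auto
          also have "\<dots> \<le> 1/3 * r powi k"
            using r by (intro mult_right_mono) auto
          finally show ?thesis by simp
        qed
        moreover have "dist x0 y \<le> dist x0 z + dist z y"
          by (rule dist_triangle)
        ultimately have "r powi j \<le> dist z y"
          by (auto simp: h_def)
        then show False
          using z(3) False by (auto simp: indep_def max_def)
      qed
    qed
  qed
qed

section \<open>Finiteness of separated sets in balls\<close>

lemma finite_doubling_cover:
  fixes x :: "'a::metric_space"
  assumes "finite_doubling TYPE('a)" "t > 0"
  shows "\<exists>F. finite F \<and> cball x (2 ^ m * t) \<subseteq> (\<Union>y\<in>F. cball y t)"
proof (induction m arbitrary: x)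
  case 0
  show ?case by (rule exI[of _ "{x}"]) simp
next
  case (Suc m)
  obtain F where F: "finite F" "cball x (2 * (2 ^ m * t)) \<subseteq> (\<Union>y\<in>F. cball y (2 ^ m * t))"
    using assms unfolding finite_doubling_def by (metis mult_pos_pos zero_less_numeral zero_less_power)
  obtain H where H: "finite (H y)" "cball y (2 ^ m * t) \<subseteq> (\<Union>z\<in>H y. cball z t)" for y :: 'a
    using Suc.IH by metis
  have "cball x (2 ^ Suc m * t) \<subseteq> (\<Union>z\<in>(\<Union>y\<in>F. H y). cball z t)"
    using F(2) H(2) unfolding power_Suc mult.assoc by blast
  moreover have "finite (\<Union>y\<in>F. H y)"
    using F(1) H(1) by simp
  ultimately show ?case by (intro exI conjI)
qed

text \<open>A ball of radius \<open>s / 3\<close> has diameter below \<open>s\<close>, so it holds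
  at most one point of \<open>A\<close>; by iterated doubling, finitely many such balls cover
  \<open>cball x R\<close>.\<close>

lemma finite_doubling_finite_separated:
  fixes x :: "'a::metric_space" and A :: "'a set"
  assumes fd: "finite_doubling TYPE('a)" and "s > 0"
    and sep: "\<And>a b. a \<in> A \<Longrightarrow> b \<in> A \<Longrightarrow> a \<noteq> b \<Longrightarrow> s \<le> dist a b"
  shows "finite (A \<inter> cball x R)"
proof -
  obtain m where "R / (s / 3) < 2 ^ m"
    using real_arch_pow[of 2] by auto
  then have R: "R \<le> 2 ^ m * (s / 3)"
    using \<open>s > 0\<close> by (simp add: field_simps)
  obtain F where F: "finite F" "cball x (2 ^ m * (s / 3)) \<subseteq> (\<Union>y\<in>F. cball y (s / 3))"
    using finite_doubling_cover[OF fd, of "s / 3" x m] \<open>s > 0\<close> by auto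
  have "finite (A \<inter> cball y (s / 3))" for y
  proof -
    have "a = b" if ab: "a \<in> A \<inter> cball y (s / 3)" "b \<in> A \<inter> cball y (s / 3)" for a b
    proof (rule ccontr)
      assume "a \<noteq> b"
      then have "s \<le> dist a b" using sep ab by auto
      moreover have "dist a b \<le> dist y a + dist y b" by (rule dist_triangle3)
      ultimately show False using ab \<open>s > 0\<close> by simp
    qed
    then have "A \<inter> cball y (s / 3) \<subseteq> {a}" if "a \<in> A \<inter> cball y (s / 3)" for a
      using that by blast
    then show ?thesis by (metis all_not_in_conv finite.intros finite_subset)
  qed
  then have "finite (\<Union>y\<in>F. A \<inter> cball y (s / 3))" using F by blast
  moreover have "A \<inter> cball x R \<subseteq> (\<Union>y\<in>F. A \<inter> cball y (s / 3))"
    using F(2) subset_cball[OF R, of x] by blast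
  ultimately show ?thesis by (rule rev_finite_subset)
qed

lemma countable_if_finite_in_balls:
  fixes A :: "'a::metric_space set"
  assumes "\<And>R. finite (A \<inter> cball x R)"
  shows "countable A"
proof -
  have "countable (\<Union>m::nat. A \<inter> cball x (real m))"
    using assms by (intro countable_UN[OF countableI_type] countable_finite)
  moreover have "A \<subseteq> (\<Union>m::nat. A \<inter> cball x (real m))"
    by (auto intro: real_arch_simple)
  ultimately show ?thesis by (rule countable_subset[rotated])
qed

section \<open>Borel choice from countably many candidates\<close>

lemma closure_UN_finite:
  assumes "finite F"
  shows "closure (\<Union>a\<in>F. B a) = (\<Union>a\<in>F. closure (B a))"
  using assms by induction simp_all

text \<open>Choosing the admissible candidate of least index in an enumeration of \<open>S\<close>
  makes each fibre of \<open>h\<close> a Borel set minus countably many Borel sets. In the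
  applications past the first generation, \<open>g\<close> is the coarser choice and
  \<open>p\<close> the parent map.\<close>

lemma borel_selection:
  fixes g :: "'a::topological_space \<Rightarrow> 'b" and p :: "'c \<Rightarrow> 'b" and E :: "'c \<Rightarrow> 'a set"
  assumes "countable S" and cl: "\<And>b. b \<in> S \<Longrightarrow> E b \<in> sets borel"
    and g: "\<And>a. {y. g y = a} \<in> sets borel"
    and ex: "\<And>y. \<exists>b\<in>S. p b = g y \<and> y \<in> E b"
  obtains h where "\<And>y. h y \<in> S" "\<And>y. p (h y) = g y" "\<And>y. y \<in> E (h y)"
    "\<And>b. {y. h y = b} \<in> sets borel"
proof -
  define T where "T b y \<longleftrightarrow> b \<in> S \<and> p b = g y \<and> y \<in> E b" for b y
  define i where "i = to_nat_on S"
  have inj: "inj_on i S" unfolding i_def using assms(1) by (rule inj_on_to_nat_on)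
  have "\<exists>b. T b y \<and> (\<forall>b'. T b' y \<longrightarrow> i b \<le> i b')" for y
  proof -
    obtain b where "T b y" using ex[of y] unfolding T_def by blast
    then show ?thesis using arg_min_nat_lemma[of "\<lambda>b. T b y" b i] by blast
  qed
  then obtain h where h: "\<And>y. T (h y) y" "\<And>y b'. T b' y \<Longrightarrow> i (h y) \<le> i b'"
    by metis
  show thesis
  proof (rule that[of h])
    fix b
    have Tb: "{y. T b y} \<in> sets borel" for b
    proof (cases "b \<in> S")
      case True
      then have "{y. T b y} = {y. g y = p b} \<inter> E b" by (auto simp: T_def)
      then show ?thesis using g cl[OF True] by auto
    qed (simp add: T_def)
    have "h y = b \<longleftrightarrow> T b y \<and> (\<forall>b'\<in>S. i b' < i b \<longrightarrow> \<not> T b' y)" for y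
    proof
      assume "h y = b"
      then show "T b y \<and> (\<forall>b'\<in>S. i b' < i b \<longrightarrow> \<not> T b' y)" using h by (auto simp: not_le[symmetric])
    next
      assume *: "T b y \<and> (\<forall>b'\<in>S. i b' < i b \<longrightarrow> \<not> T b' y)"
      then have "i (h y) = i b"
        using h(1)[of y] h(2)[of b y] by (metis T_def le_neq_implies_less)
      then show "h y = b" using inj h(1)[of y] * by (auto simp: T_def dest: inj_onD)
    qed
    then have "{y. h y = b} = {y. T b y} - (\<Union>b'\<in>{b'\<in>S. i b' < i b}. {y. T b' y})"
      by auto
    then show "{y. h y = b} \<in> sets borel"
      using Tb assms(1) by (auto intro!: sets.Diff sets.countable_UN')
  qed (use h in \<open>auto simp: T_def\<close>)
qed

section \<open>Parents, ancestors and descendants\<close>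

locale nested_nets =
  fixes A :: "int \<Rightarrow> 'a::metric_space set" and r :: real
  assumes r: "0 < r" "r < 1"
    and nested: "A k \<subseteq> A (k + 1)"
    and separated: "a \<in> A k \<Longrightarrow> b \<in> A k \<Longrightarrow> a \<noteq> b \<Longrightarrow> r powi k \<le> dist a b"
    and net: "\<exists>a\<in>A k. dist y a < r powi k"
    and locally_finite: "finite (A k \<inter> cball y R)"
begin

lemma powi_pos [simp]: "0 < r powi k"
  using r by simp

lemma powi_add_one: "r powi (k + 1) = r * r powi k"
  using r by (simp add: power_int_add)

text \<open>The outer radius is the geometric series \<open>r powi k + r powi (k + 1) + ...\<close>;
  splitting off its first term pays for one parent step.\<close>

lemma outer_radius_step: "1 / (1 - r) * r powi k = r powi k + 1 / (1 - r) * r powi (k + 1)"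
  using r unfolding powi_add_one by (simp add: field_simps)

lemma countable_net: "countable (A k)"
  by (rule countable_if_finite_in_balls) (rule locally_finite)

lemma ex_nearest: "\<exists>a. a \<in> A k \<and> (\<forall>b\<in>A k. dist y a \<le> dist y b)"
proof -
  obtain a0 where a0: "a0 \<in> A k" "dist y a0 < r powi k" using net by blast
  \<comment> \<open>Only this finite set competes: it contains \<open>a0\<close>, and net points
    outside it are farther from \<open>y\<close> than \<open>a0\<close>.\<close>
  let ?F = "A k \<inter> cball y (r powi k)"
  have "a0 \<in> ?F" using a0 by simp
  then obtain a where a: "a \<in> ?F" "\<forall>b\<in>?F. dist y a \<le> dist y b"
    using ex_min_if_finite[of "dist y ` ?F"] locally_finite[of k y "r powi k"]
    by (force simp: not_less)
  then show ?thesis by fastforce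
qed

definition nearest :: "int \<Rightarrow> 'a \<Rightarrow> 'a" where
  "nearest k y = (SOME a. a \<in> A k \<and> (\<forall>b\<in>A k. dist y a \<le> dist y b))"

lemma nearest_in: "nearest k y \<in> A k"
  and nearest_le: "b \<in> A k \<Longrightarrow> dist y (nearest k y) \<le> dist y b"
  using someI_ex[OF ex_nearest[of k y]] unfolding nearest_def by blast+

lemma dist_nearest: "dist y (nearest k y) < r powi k"
  using net[of k y] nearest_le[of _ k y] by force

lemma nearest_eqI:
  assumes "a \<in> A k" "dist y a < r powi k / 2"
  shows "nearest k y = a"
proof (rule ccontr)
  assume "nearest k y \<noteq> a"
  then have "r powi k \<le> dist (nearest k y) a" by (intro separated nearest_in assms)
  also have "\<dots> \<le> dist y (nearest k y) + dist y a" by (rule dist_triangle3)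
  also have "\<dots> \<le> dist y a + dist y a" using nearest_le[OF assms(1)] by simp
  finally show False using assms(2) by simp
qed

lemma nearest_self: "a \<in> A k \<Longrightarrow> nearest k a = a"
  by (rule nearest_eqI) simp_all

text \<open>\<open>z\<close> is meant as a centre of generation \<open>k + int n\<close>, carried to
  generation \<open>k\<close> by \<open>n\<close> parent steps.\<close>

fun ancestor :: "int \<Rightarrow> nat \<Rightarrow> 'a \<Rightarrow> 'a" where
  "ancestor k 0 z = z"
| "ancestor k (Suc n) z = nearest k (ancestor (k + 1) n z)"

lemma ancestor_in: "z \<in> A (k + int n) \<Longrightarrow> ancestor k n z \<in> A k"
  by (cases n) (simp_all add: nearest_in)

lemma dist_ancestor: "dist z (ancestor k n z) \<le> 1 / (1 - r) * r powi k"
proof (induction n arbitrary: k)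
  case 0
  show ?case using r by simp
next
  case (Suc n)
  let ?b = "ancestor (k + 1) n z"
  have "dist z (nearest k ?b) \<le> dist z ?b + dist ?b (nearest k ?b)"
    by (rule dist_triangle)
  also have "\<dots> \<le> 1 / (1 - r) * r powi (k + 1) + r powi k"
    using Suc[of "k + 1"] dist_nearest[of ?b k] by simp
  finally show ?case using outer_radius_step[of k] by simp
qed

definition descendants :: "int \<Rightarrow> 'a \<Rightarrow> 'a set" where
  "descendants k a = {z. \<exists>n. z \<in> A (k + int n) \<and> ancestor k n z = a}"

lemma closure_descendants_subset: "closure (descendants k a) \<subseteq> cball a (1 / (1 - r) * r powi k)"
  using dist_ancestor by (intro closure_minimal) (auto simp: descendants_def dist_commute)

text \<open>Centres of fine generations approximate \<open>y\<close>, and their ancestors stay at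
  bounded distance. So only finitely many centres of generation \<open>k\<close> occur, and closure
  commutes with the finite union.\<close>

lemma closure_descendants_cover: "\<exists>a\<in>A k. y \<in> closure (descendants k a)"
proof -
  \<comment> \<open>The summand 1 allows for \<open>dist y z < 1\<close> below, so that
    \<open>F\<close> does not depend on \<open>e\<close>.\<close>
  define F where "F = A k \<inter> cball y (1 + 1 / (1 - r) * r powi k)"
  have "y \<in> closure (\<Union>a\<in>F. descendants k a)"
    unfolding closure_approachable
  proof (intro allI impI)
    fix e :: real assume "e > 0"
    then have "0 < min e 1 / r powi k" by simp
    then obtain n where n: "r ^ n < min e 1 / r powi k"
      using real_arch_pow_inv[of _ r] r by blast
    then have "r powi (k + int n) < min e 1"
      using r by (simp add: power_int_add field_simps)
    moreover obtain z where z: "z \<in> A (k + int n)" "dist y z < r powi (k + int n)"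
      using net by blast
    ultimately have yz: "dist y z < e" "dist y z < 1" by auto
    let ?a = "ancestor k n z"
    have "?a \<in> F"
      using dist_triangle[of y ?a z] dist_ancestor[of z k n] yz ancestor_in[OF z(1)]
      by (simp add: F_def)
    moreover have "z \<in> descendants k ?a" using z by (auto simp: descendants_def)
    ultimately show "\<exists>z\<in>\<Union>a\<in>F. descendants k a. dist z y < e"
      using yz by (metis UN_I dist_commute)
  qed
  moreover have "finite F" unfolding F_def by (rule locally_finite)
  ultimately have "y \<in> (\<Union>a\<in>F. closure (descendants k a))"
    by (simp add: closure_UN_finite)
  then show ?thesis by (auto simp: F_def)
qed

text \<open>The children of \<open>a\<close> lie within \<open>r powi k\<close> of it, hence are
  finitely many, and every descendant of \<open>a\<close> descends from one of them.\<close>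

lemma closure_descendants_child:
  assumes "a \<in> A k" "y \<in> closure (descendants k a)"
  shows "\<exists>b\<in>A (k + 1). nearest k b = a \<and> y \<in> closure (descendants (k + 1) b)"
proof -
  define F where "F = {b \<in> A (k + 1). nearest k b = a}"
  have "dist a b \<le> r powi k" if "nearest k b = a" for b
    using dist_nearest[of b k] that by (simp add: dist_commute)
  then have "F \<subseteq> A (k + 1) \<inter> cball a (r powi k)"
    by (auto simp: F_def)
  then have fin: "finite F" by (rule finite_subset) (rule locally_finite)
  have "descendants k a \<subseteq> (\<Union>b\<in>F. descendants (k + 1) b)"
  proof
    fix z assume "z \<in> descendants k a"
    then obtain n where n: "z \<in> A (k + int n)" "ancestor k n z = a"
      by (auto simp: descendants_def)
    show "z \<in> (\<Union>b\<in>F. descendants (k + 1) b)"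
    proof (cases n)
      \<comment> \<open>A centre persists in the next generation and is its own nearest centre,
        hence its own child.\<close>
      case 0
      then have "z = a" "a \<in> A (k + 1)" using n nested by auto
      moreover from this have "a \<in> descendants (k + 1) a"
        by (auto simp: descendants_def intro!: exI[of _ 0])
      ultimately show ?thesis using assms(1) by (auto simp: F_def nearest_self)
    next
      case (Suc m)
      let ?b = "ancestor (k + 1) m z"
      have z: "z \<in> A (k + 1 + int m)" using n Suc by (simp add: algebra_simps)
      then have "?b \<in> F" using n Suc ancestor_in[OF z] by (simp add: F_def)
      moreover have "z \<in> descendants (k + 1) ?b" using z by (auto simp: descendants_def)
      ultimately show ?thesis by blast
    qed
  qed
  then have "closure (descendants k a) \<subseteq> (\<Union>b\<in>F. closure (descendants (k + 1) b))"
    unfolding closure_UN_finite[OF fin, symmetric] by (rule closure_mono)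
  then show ?thesis using assms(2) by (auto simp: F_def)
qed

section \<open>A coherent Borel choice of centres\<close>

lemma ex_selection_nat:
  obtains f :: "nat \<Rightarrow> 'a \<Rightarrow> 'a" where
    "\<And>n y. f n y \<in> A (int n)"
    "\<And>n y. nearest (int n) (f (Suc n) y) = f n y"
    "\<And>n y. dist y (f n y) \<le> 1 / (1 - r) * r powi int n"
    "\<And>n a. {y. f n y = a} \<in> sets borel"
proof -
  define P where "P n g \<longleftrightarrow> (\<forall>y. g y \<in> A (int n)) \<and> (\<forall>y. y \<in> closure (descendants (int n) (g y)))
    \<and> (\<forall>a. {y. g y = a} \<in> sets borel)" for n g
  have "\<exists>f. \<forall>n. P n (f n) \<and> (\<forall>y. nearest (int n) (f (Suc n) y) = f n y)"
  proof (rule dependent_nat_choice)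
    \<comment> \<open>The first generation has no coarser choice to match;
      \<open>unit\<close>-valued maps make that constraint trivial.\<close>
    obtain h where "\<And>y. h y \<in> A 0" "\<And>y. y \<in> closure (descendants 0 (h y))"
      "\<And>b. {y. h y = b} \<in> sets borel"
      using borel_selection[of "A 0" "\<lambda>a. closure (descendants 0 a)" "\<lambda>_. ()" "\<lambda>_. ()"]
        countable_net closure_descendants_cover[of 0] by auto
    then show "\<exists>g. P 0 g" by (auto simp: P_def)
  next
    fix g n assume g: "P n g"
    have "\<exists>b\<in>A (int n + 1). nearest (int n) b = g y \<and> y \<in> closure (descendants (int n + 1) b)" for y
      using g by (intro closure_descendants_child) (auto simp: P_def)
    then obtain h where "\<And>y. h y \<in> A (int n + 1)" "\<And>y. nearest (int n) (h y) = g y"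
      "\<And>y. y \<in> closure (descendants (int n + 1) (h y))" "\<And>b. {y. h y = b} \<in> sets borel"
      using borel_selection[of "A (int n + 1)" "\<lambda>b. closure (descendants (int n + 1) b)" g
          "nearest (int n)"] countable_net g by (auto simp: P_def)
    then show "\<exists>h. P (Suc n) h \<and> (\<forall>y. nearest (int n) (h y) = g y)"
      by (auto simp: P_def add.commute)
  qed
  then obtain f where f: "\<And>n. P n (f n)" "\<And>n y. nearest (int n) (f (Suc n) y) = f n y"
    by blast
  then show thesis
  proof (intro that[of f])
    show "dist y (f n y) \<le> 1 / (1 - r) * r powi int n" for n y
      using f(1)[of n] closure_descendants_subset[of "int n" "f n y"]
      by (auto simp: P_def dist_commute)
  qed (use f in \<open>auto simp: P_def\<close>)
qed

lemma ex_selection: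
  obtains s :: "int \<Rightarrow> 'a \<Rightarrow> 'a" where
    "\<And>k y. s k y \<in> A k"
    "\<And>k y. nearest k (s (k + 1) y) = s k y"
    "\<And>k y. dist y (s k y) \<le> 1 / (1 - r) * r powi k"
    "\<And>k a. {y. s k y = a} \<in> sets borel"
proof -
  obtain f :: "nat \<Rightarrow> 'a \<Rightarrow> 'a" where f: "\<And>n y. f n y \<in> A (int n)"
    "\<And>n y. nearest (int n) (f (Suc n) y) = f n y"
    "\<And>n y. dist y (f n y) \<le> 1 / (1 - r) * r powi int n"
    "\<And>n a. {y. f n y = a} \<in> sets borel"
    by (rule ex_selection_nat) (rule that)
  \<comment> \<open>Below generation 0 nothing is left to choose: coherence forces the ancestors of
    \<open>f 0\<close>.\<close>
  define s where "s k = (if k \<ge> 0 then f (nat k) else ancestor k (nat (- k)) \<circ> f 0)" for k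
  have nn: "s (int n) = f n" for n by (simp add: s_def)
  have neg: "s (- int n) = ancestor (- int n) n \<circ> f 0" for n
    by (cases "n = 0") (auto simp: s_def)
  have coherent: "nearest k (s (k + 1) y) = s k y" for k y
  proof (cases "k \<ge> 0")
    case True
    then obtain n where "k = int n" by (metis nonneg_int_cases)
    then show ?thesis using f(2)[of n y] nn[of "Suc n"] by (simp add: nn add.commute)
  next
    case False
    then obtain n where "k = - int (Suc n)" by (metis neg_int_cases not_le Suc_pred)
    then show ?thesis using neg[of n] neg[of "Suc n"] by simp
  qed
  show thesis
  proof (rule that[of s])
    show "s k y \<in> A k" for k y
      using coherent[of k y] nearest_in[of k "s (k + 1) y"] by simp
    show "dist y (s k y) \<le> 1 / (1 - r) * r powi k" for k y
    proof (cases k rule: int_cases2)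
      case (nonneg n)
      then show ?thesis using f(3)[of y n] by (simp add: nn)
    next
      case (nonpos n)
      \<comment> \<open>The bound is known from generation 0 on; towards coarser generations each
        parent step adds one term of the series.\<close>
      have "dist y (s (- int n) y) \<le> 1 / (1 - r) * r powi (- int n)"
      proof (induction n)
        case 0
        show ?case using f(3)[of y 0] nn[of 0] by simp
      next
        case (Suc n)
        define k where "k = - int (Suc n)"
        have k: "k + 1 = - int n" by (simp add: k_def)
        have "dist y (s k y) \<le> dist y (s (k + 1) y) + dist (s (k + 1) y) (s k y)"
          by (rule dist_triangle)
        also have "\<dots> \<le> 1 / (1 - r) * r powi (k + 1) + r powi k"
          using Suc dist_nearest[of "s (k + 1) y" k] coherent[of k y] k by simp
        finally show ?case unfolding k_def[symmetric] outer_radius_step[of k] by simp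
      qed
      then show ?thesis using nonpos by simp
    qed
    show "{y. s k y = a} \<in> sets borel" for k a
    proof (cases k rule: int_cases2)
      case (nonneg n)
      then show ?thesis using f(4)[of n a] by (simp add: nn)
    next
      case (nonpos n)
      have "{y. s k y = a} = (\<Union>b\<in>{b\<in>A 0. ancestor k n b = a}. {y. f 0 y = b})"
        using f(1)[of 0] by (auto simp: nonpos neg)
      then show ?thesis
        using f(4) countable_net by (auto intro!: sets.countable_UN')
    qed
  qed (rule coherent)
qed

end

section \<open>Assembly of the cubes\<close>

theorem theorem2p1:
  fixes r c C :: real
  assumes "finite_doubling TYPE('a::metric_space)"
    and "0 < r" and "r < 1/3"
    and "c = 1/2 - r / (1 - r)"
    and "C = 1 / (1 - r)"
  shows "\<exists>(N :: int \<Rightarrow> nat set) (Q :: int \<Rightarrow> nat \<Rightarrow> 'a set) (x :: int \<Rightarrow> nat \<Rightarrow> 'a).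
     (\<forall>k. \<forall>i\<in>N k. Q k i \<in> sets borel) \<and>
     (\<forall>k. (\<Union>i\<in>N k. Q k i) = UNIV) \<and>
     (\<forall>k m. k \<ge> m \<longrightarrow> (\<forall>i\<in>N k. \<forall>j\<in>N m. Q k i \<inter> Q m j = {} \<or> Q k i \<subseteq> Q m j)) \<and>
     (\<forall>k. \<forall>i\<in>N k. ball (x k i) (c * r powi k) \<subseteq> Q k i \<and> Q k i \<subseteq> cball (x k i) (C * r powi k)) \<and>
     (\<exists>x0. \<forall>k. \<exists>i\<in>N k. ball x0 (c * r powi k) \<subseteq> Q k i) \<and>
     (\<forall>k. x k ` N k \<subseteq> x (k + 1) ` N (k + 1))"
proof -
  \<comment> \<open>An arbitrary point of the type; as a centre of every generation it will witness
    the common centre.\<close>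
  define x0 :: 'a where "x0 = undefined"
  obtain A where A: "\<And>k. x0 \<in> A k" "\<And>k. A k \<subseteq> A (k + 1)"
    "\<And>k a b. a \<in> A k \<Longrightarrow> b \<in> A k \<Longrightarrow> a \<noteq> b \<Longrightarrow> r powi k \<le> dist a b"
    "\<And>k y. \<exists>a\<in>A k. dist y a < r powi k"
    using ex_nested_nets[of r x0] assms(2,3) by auto
  interpret nested_nets A r
  proof
    \<comment> \<open>Doubling enters through this local finiteness alone.\<close>
    show "finite (A k \<inter> cball y R)" for k y R
      using finite_doubling_finite_separated[OF assms(1), of "r powi k" "A k"] A(3) assms(2) by auto
  qed (use A assms(2,3) in auto)
  obtain s :: "int \<Rightarrow> 'a \<Rightarrow> 'a" where s: "\<And>k y. s k y \<in> A k"
    "\<And>k y. nearest k (s (k + 1) y) = s k y"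
    "\<And>k y. dist y (s k y) \<le> 1 / (1 - r) * r powi k"
    "\<And>k a. {y. s k y = a} \<in> sets borel"
    by (rule ex_selection) (rule that)
  have inner: "s k y = a" if a: "a \<in> A k" and y: "y \<in> ball a (c * r powi k)" for k a y
  proof -
    have "dist (s (k + 1) y) a \<le> dist y (s (k + 1) y) + dist y a"
      by (rule dist_triangle3)
    also have "\<dots> < C * r powi (k + 1) + c * r powi k"
      using s(3)[of y "k + 1"] y by (simp add: dist_commute assms(5))
    \<comment> \<open>\<open>c\<close> is one half minus \<open>r * C\<close>, chosen so that the
      sum is the threshold of \<open>nearest_eqI\<close>.\<close>
    also have "\<dots> = r powi k / 2"
      unfolding powi_add_one assms(4,5) by (simp add: algebra_simps)
    finally show ?thesis using nearest_eqI[OF a] s(2) by metis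
  qed
  \<comment> \<open>The parent map determines each choice from the next finer one, so agreement
    passes to coarser generations; this is the nesting of the cubes.\<close>
  have coarser: "s m y = s m z" if "m \<le> k" "s k y = s k z" for m k y z
    using that
  proof (induction m rule: int_le_induct)
    case (step i)
    then show ?case using s(2)[of "i - 1"] by (metis diff_add_cancel)
  qed simp
  \<comment> \<open>One enumeration of all centres serves every generation, so \<open>x k\<close>
    does not depend on \<open>k\<close> and each index keeps its centre.\<close>
  define U where "U = (\<Union>k. A k)"
  have "countable U" unfolding U_def using countable_net by blast
  define x where "x = (\<lambda>_::int. from_nat_into U)"
  define N where "N = (\<lambda>k. to_nat_on U ` A k)"
  define Q where "Q k i = {y. s k y = x k i}" for k i
  have x: "x k (to_nat_on U a) = a" if "a \<in> A k" for k a
    unfolding x_def using that \<open>countable U\<close> by (intro from_nat_into_to_nat_on) (auto simp: U_def)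
  have ball: "ball a (c * r powi k) \<subseteq> Q k (to_nat_on U a)" if "a \<in> A k" for k a
    using inner[OF that] x[OF that] by (auto simp: Q_def)
  have img: "x k ` N k = A k" for k
    by (simp add: N_def image_image x cong: image_cong_simp)
  show ?thesis
  proof (intro exI[of _ N] exI[of _ Q] exI[of _ x] conjI)
    show "\<forall>k. \<forall>i\<in>N k. Q k i \<in> sets borel" by (simp add: Q_def s)
    show "\<forall>k. (\<Union>i\<in>N k. Q k i) = UNIV"
      using s(1) by (auto simp: Q_def N_def x)
    show "\<forall>k m. k \<ge> m \<longrightarrow> (\<forall>i\<in>N k. \<forall>j\<in>N m. Q k i \<inter> Q m j = {} \<or> Q k i \<subseteq> Q m j)"
    proof (intro allI impI ballI)
      fix k m :: int and i j assume "m \<le> k"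
      have "Q k i \<subseteq> Q m j" if "y \<in> Q k i" "y \<in> Q m j" for y
      proof
        fix z assume "z \<in> Q k i"
        then have "s k z = s k y" using that by (simp add: Q_def)
        from coarser[OF \<open>m \<le> k\<close> this] show "z \<in> Q m j" using that by (simp add: Q_def)
      qed
      then show "Q k i \<inter> Q m j = {} \<or> Q k i \<subseteq> Q m j" by blast
    qed
    show "\<forall>k. \<forall>i\<in>N k. ball (x k i) (c * r powi k) \<subseteq> Q k i \<and> Q k i \<subseteq> cball (x k i) (C * r powi k)"
    proof (intro allI ballI conjI)
      fix k i assume "i \<in> N k"
      then obtain a where a: "a \<in> A k" "i = to_nat_on U a" by (auto simp: N_def)
      show "ball (x k i) (c * r powi k) \<subseteq> Q k i" using ball[OF a(1)] x[OF a(1)] a(2) by simp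
      show "Q k i \<subseteq> cball (x k i) (C * r powi k)"
      proof
        fix y assume "y \<in> Q k i"
        then show "y \<in> cball (x k i) (C * r powi k)"
          using s(3)[of y k] by (simp add: Q_def dist_commute assms(5))
      qed
    qed
    show "\<exists>x0. \<forall>k. \<exists>i\<in>N k. ball x0 (c * r powi k) \<subseteq> Q k i"
    proof (intro exI allI bexI)
      show "ball x0 (c * r powi k) \<subseteq> Q k (to_nat_on U x0)" for k
        by (rule ball) (rule A(1))
      show "to_nat_on U x0 \<in> N k" for k
        unfolding N_def by (rule imageI) (rule A(1))
    qed
    show "\<forall>k. x k ` N k \<subseteq> x (k + 1) ` N (k + 1)" unfolding img using nested by blast
  qed
qed

end
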